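(* For all natural numbers $m,n$, every list $O$ of oracles and every list $R$ of comparator networks, if $\mathrm{GP}(m,n,O)=\mathsf{no}(m,n,R)$, then every sorting network on $m$ channels has size strictly greater than $n$.
   Context: A comparator is a pair $(i,j)$ of natural numbers; a comparator network is a finite list of comparators, and its size is the number of comparators. $C_1;C_2$ denotes concatenation. A network is a network on $n$ channels if every comparator $(i,j)$ has $i<n$, $j<n$, $i\neq j$; it is standard on $n$ channels if every comparator has $i<j<n$. For $\vec x=(x_0,\ldots,x_{n-1})\in\{0,1\}^n$, applying comparator $(i,j)$ leaves $\vec x$ unchanged if $x_i\le x_j$ and otherwise swaps the entries at positions $i$ and $j$; $C(\vec x)$ applies the comparators of $C$ in order; $\mathsf{outputs}(C)=\{C(\vec x):\vec x\in\{0,1\}^n\}$. $C$ is a sorting network on $n$ channels if it is a network on $n$ channels and $C(\vec x)$ is nondecreasing for all $\vec x\in\{0,1\}^n$. A comparator $c=(i,j)$ is redundant after $C_1$ if $C_1(\vec x)_i\le C_1(\vec x)_j$ for all $\vec x\in\{0,1\}^n$. $\mathrm{OGenerate}(R,n)$ is the list of all $C;(i,j)$ with $C\in R$, $i<j<n$, and $(i,j)$ not redundant after $C$. An oracle is a finite list of triples $(C,C',\pi)$ with $C,C'$ networks and $\pi$ a finite list of naturals. A list $\pi=[\pi_0,\ldots,\pi_{m'-1}]$ represents a permutation of $\{0,\ldots,n-1\}$ if $m'=n$, all $\pi_i<n$ and they are pairwise distinct; then $\pi(\vec x)=\vec y$ with $y_{\pi_i}=x_i$, and $C\le_\pi C'$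 means $\{\pi(\vec x):\vec x\in\mathsf{outputs}(C)\}\subseteq\mathsf{outputs}(C')$. $\mathrm{Prune}(X,R,n)$: if $X$ is empty return $R$; if $X=(C,C',\pi)::X'$, then if $C=C'$, or $C\notin R$, or $\pi$ does not represent a permutation of $\{0,\ldots,n-1\}$, or not $C\le_\pi C'$, return $R$; otherwise return $\mathrm{Prune}(X',R\setminus C',n)$ ($R$ with all occurrences of $C'$ removed). The procedure $\mathrm{GP}(m,n,O)$, with $O$ a list of oracles, returns one of $\mathsf{yes}(p,q)$, $\mathsf{no}(p,q,R)$ ($R$ a list of networks), or $\mathsf{maybe}$, and is defined by recursion on $n$: $\mathrm{GP}(m,0,O)$ is $\mathsf{yes}(0,0)$ if $m=0$, $\mathsf{yes}(1,0)$ if $m=1$, and $\mathsf{no}(m,0,[\emptyset])$ otherwise (where $\emptyset$ is the empty network). $\mathrm{GP}(m,n+1,O)$ is $\mathsf{maybe}$ if $O$ is empty; if $O=X::O'$, let $G=\mathrm{GP}(m,n,O')$: if $G=\mathsf{maybe}$ return $\mathsf{maybe}$; if $G=\mathsf{yes}(p,q)$ return $\mathsf{yes}(p,q)$; if $G=\mathsf{no}(p,q,R)$, let $R'=\mathrm{Prune}(X,\mathrm{OGenerate}(R,p),p)$, and return $\mathsf{yes}(p,q+1)$ if some element of $R'$ is a sorting network on $p$ channels, and $\mathsf{no}(p,q+1,R')$ otherwise. *)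

theory Defs
  imports Main
begin

type_synonym comparator = "nat \<times> nat"
type_synonym network = "comparator list"
type_synonym gp_oracle = "(network \<times> network \<times> nat list) list"

text \<open>A vector in \<open>{0,1}\<^sup>n\<close> is a \<open>bool list\<close> of length \<open>n\<close>, with \<open>False < True\<close>
  standing for \<open>0 < 1\<close>; the size of a network is its \<^const>\<open>length\<close>.\<close>

definition network_on :: "nat \<Rightarrow> network \<Rightarrow> bool" where
  "network_on n C \<longleftrightarrow> (\<forall>(i, j) \<in> set C. i < n \<and> j < n \<and> i \<noteq> j)"

text \<open>A comparator that addresses a position outside the vector does nothing. This only fixes a
  value for networks that are not networks on \<open>n\<close> channels, which oracles may contain.\<close>

fun apply_comparator :: "comparator \<Rightarrow> bool list \<Rightarrow> bool list" where
  "apply_comparator (i, j) x =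
    (if i < length x \<and> j < length x \<and> \<not> x ! i \<le> x ! j then x[i := x ! j, j := x ! i] else x)"

definition apply_network :: "network \<Rightarrow> bool list \<Rightarrow> bool list" where
  "apply_network C x = fold apply_comparator C x"

definition outputs :: "nat \<Rightarrow> network \<Rightarrow> bool list set" where
  "outputs n C = {apply_network C x | x. length x = n}"

definition sorting_network :: "nat \<Rightarrow> network \<Rightarrow> bool" where
  "sorting_network n C \<longleftrightarrow>
    network_on n C \<and> (\<forall>x. length x = n \<longrightarrow> sorted (apply_network C x))"

fun redundant :: "nat \<Rightarrow> network \<Rightarrow> comparator \<Rightarrow> bool" where
  "redundant n C (i, j) \<longleftrightarrow>
    (\<forall>x. length x = n \<longrightarrow> apply_network C x ! i \<le> apply_network C x ! j)"

definition OGenerate :: "network list \<Rightarrow> nat \<Rightarrow> network list" where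
  "OGenerate R n =
    [C @ [(i, j)]. C \<leftarrow> R, i \<leftarrow> [0..<n], j \<leftarrow> [0..<n], i < j \<and> \<not> redundant n C (i, j)]"

definition represents_perm :: "nat \<Rightarrow> nat list \<Rightarrow> bool" where
  "represents_perm n \<pi> \<longleftrightarrow> length \<pi> = n \<and> (\<forall>k \<in> set \<pi>. k < n) \<and> distinct \<pi>"

text \<open>The vector \<open>y\<close> with \<open>y ! (\<pi> ! i) = x ! i\<close>, see \<open>permute_nth\<close> below.\<close>

definition permute :: "nat list \<Rightarrow> bool list \<Rightarrow> bool list" where
  "permute \<pi> x = map (\<lambda>k. x ! (THE i. i < length x \<and> \<pi> ! i = k)) [0..<length x]"

lemma length_permute [simp]: "length (permute \<pi> x) = length x"
  by (simp add: permute_def)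

lemma permute_nth:
  assumes "represents_perm n \<pi>" "length x = n" "i < n"
  shows "permute \<pi> x ! (\<pi> ! i) = x ! i"
proof -
  have "(THE i'. i' < length x \<and> \<pi> ! i' = \<pi> ! i) = i"
    using assms by (intro the_equality) (auto simp: represents_perm_def nth_eq_iff_index_eq)
  moreover have "\<pi> ! i < length x"
    using assms by (auto simp: represents_perm_def)
  ultimately show ?thesis
    by (simp add: permute_def)
qed

definition subsumes :: "nat \<Rightarrow> network \<Rightarrow> nat list \<Rightarrow> network \<Rightarrow> bool" where
  "subsumes n C \<pi> C' \<longleftrightarrow> permute \<pi> ` outputs n C \<subseteq> outputs n C'"

fun Prune :: "gp_oracle \<Rightarrow> network list \<Rightarrow> nat \<Rightarrow> network list" where
  "Prune [] R n = R"
| "Prune ((C, C', \<pi>) # X) R n =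
    (if C = C' \<or> C \<notin> set R \<or> \<not> represents_perm n \<pi> \<or> \<not> subsumes n C \<pi> C'
     then R
     else Prune X (removeAll C' R) n)"

datatype answer = Yes nat nat | No nat nat "network list" | Maybe

fun GP :: "nat \<Rightarrow> nat \<Rightarrow> gp_oracle list \<Rightarrow> answer" where
  "GP m 0 Os = (if m = 0 then Yes 0 0 else if m = 1 then Yes 1 0 else No m 0 [[]])"
| "GP m (Suc n) [] = Maybe"
| "GP m (Suc n) (X # Os) =
    (case GP m n Os of
       Maybe \<Rightarrow> Maybe
     | Yes p q \<Rightarrow> Yes p q
     | No p q R \<Rightarrow>
         (let R' = Prune X (OGenerate R p) p
          in if \<exists>C \<in> set R'. sorting_network p C then Yes p (q + 1) else No p (q + 1) R'))"

end

theory Submission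
  imports Defs "HOL-Library.Multiset" "HOL-Combinatorics.Transposition"
begin

text \<open>A network is called collapsing if vectors with equally many ones have the same image. Sorting
  networks collapse, and a standard collapsing network sorts, because it fixes sorted vectors.
  Unlike sorting, collapsing survives a renaming of the channels of a suffix. So, if \<open>s\<close> is the size
  of a sorting network on \<open>m\<close> channels, then at every stage \<open>k\<close> of the procedure some network in
  \<open>R\<close> has a collapsing extension by at most \<open>s - k\<close> comparators, which need not be standard:
  reversing the first comparator of the extension or replacing a subsumed network merely renames
  the channels of the rest. If \<open>s \<le> k\<close>, the extension is empty and \<open>R\<close> contains a sorting network.
  Hence the standardisation of arbitrary sorting networks is never needed.\<close>

section \<open>Collapsing networks and renamings of vectors\<close>

definition standard :: "nat \<Rightarrow> network \<Rightarrow> bool" where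
  "standard n C \<longleftrightarrow> (\<forall>(i, j) \<in> set C. i < j \<and> j < n)"

definition collapsing :: "nat \<Rightarrow> network \<Rightarrow> bool" where
  "collapsing n C \<longleftrightarrow>
    (\<forall>x y. length x = n \<longrightarrow> length y = n \<longrightarrow> mset x = mset y \<longrightarrow>
      apply_network C x = apply_network C y)"

text \<open>A relation, not a function: this treats the exchange of two channels and
  \<open>permute \<pi>\<close> (the case \<open>f = (!) \<pi>\<close>) alike, without an inverse of
  \<open>f\<close>.\<close>

definition renamed :: "nat \<Rightarrow> (nat \<Rightarrow> nat) \<Rightarrow> bool list \<Rightarrow> bool list \<Rightarrow> bool" where
  "renamed n f x y \<longleftrightarrow> length x = n \<and> length y = n \<and> (\<forall>i<n. y ! f i = x ! i)"

lemma apply_network_Nil [simp]: "apply_network [] x = x"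
  by (simp add: apply_network_def)

lemma apply_network_Cons [simp]:
  "apply_network (c # C) x = apply_network C (apply_comparator c x)"
  by (simp add: apply_network_def)

lemma apply_network_append [simp]:
  "apply_network (C @ D) x = apply_network D (apply_network C x)"
  by (simp add: apply_network_def)

lemma length_apply_comparator [simp]: "length (apply_comparator c x) = length x"
  by (cases c) simp

lemma length_apply_network [simp]: "length (apply_network C x) = length x"
  by (induction C arbitrary: x) simp_all

lemma mset_apply_comparator [simp]: "mset (apply_comparator c x) = mset x"
  by (cases c) (auto simp: mset_swap simp del: le_bool_def)

lemma mset_apply_network [simp]: "mset (apply_network C x) = mset x"
  by (induction C arbitrary: x) simp_all

section \<open>Sorting versus collapsing\<close>

lemma apply_comparator_redundant:
  "x ! i \<le> x ! j \<Longrightarrow> apply_comparator (i, j) x = x"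
  by simp

lemma apply_network_standard_sorted:
  assumes "standard n C" "sorted x" "length x = n"
  shows "apply_network C x = x"
  using assms(1)
proof (induction C)
  case (Cons c C)
  obtain i j where c: "c = (i, j)" by (cases c)
  have "i < j" "j < n" using Cons.prems c by (auto simp: standard_def)
  then have "x ! i \<le> x ! j" using assms by (auto intro: sorted_nth_mono simp del: le_bool_def)
  then have "apply_comparator c x = x"
    unfolding c using apply_comparator_redundant by blast
  moreover have "standard n C" using Cons.prems by (simp add: standard_def)
  ultimately show ?case using Cons.IH by simp
qed simp

text \<open>Comparators only move entries around, and a multiset has exactly one sorted
  arrangement.\<close>

lemma sorting_network_imp_collapsing:
  assumes "sorting_network n C"
  shows "collapsing n C"
  unfolding collapsing_def
proof (intro allI impI)
  fix x y :: "bool list"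
  assume "length x = n" "length y = n" "mset x = mset y"
  then have "sorted (apply_network C x)" "sorted (apply_network C y)"
    "mset (apply_network C x) = mset (apply_network C y)"
    using assms by (auto simp: sorting_network_def)
  then show "apply_network C x = apply_network C y"
    by (metis properties_for_sort)
qed

text \<open>\<open>x\<close> and \<open>sort x\<close> have the same image, and
  \<open>sort x\<close> is a fixed point of \<open>C\<close>.\<close>

lemma standard_collapsing_imp_sorting_network:
  assumes "standard n C" "collapsing n C"
  shows "sorting_network n C"
proof -
  have "sorted (apply_network C x)" if "length x = n" for x
  proof -
    have "apply_network C x = apply_network C (sort x)"
      using assms(2) that unfolding collapsing_def by (metis length_sort mset_sort)
    also have "\<dots> = sort x"
      using assms(1) that by (simp add: apply_network_standard_sorted)
    finally show ?thesis by simp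
  qed
  moreover have "network_on n C"
    using assms(1) by (fastforce simp: standard_def network_on_def)
  ultimately show ?thesis by (simp add: sorting_network_def)
qed

section \<open>Renaming the channels of a suffix\<close>

lemma renamed_inj:
  assumes "renamed n f x y" "renamed n f x' y"
  shows "x = x'"
  using assms by (auto simp: renamed_def intro: nth_equalityI)

text \<open>By surjectivity every position of \<open>y\<close> is some \<open>f i\<close>, whose
  entry is prescribed by \<open>x\<close>.\<close>

lemma renamed_unique:
  assumes "bij_betw f {..<n} {..<n}" "renamed n f x y" "renamed n f x y'"
  shows "y = y'"
proof (rule nth_equalityI)
  show "length y = length y'" using assms by (simp add: renamed_def)
  fix k assume "k < length y"
  then have "k \<in> f ` {..<n}" using assms by (simp add: renamed_def bij_betw_def)
  then show "y ! k = y' ! k" using assms by (auto simp: renamed_def)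
qed

lemma renamed_mset:
  assumes "bij_betw f {..<n} {..<n}" "renamed n f x y"
  shows "mset y = mset x"
proof -
  \<comment> \<open>Expressing a list's multiset through its index set allows reindexing along the
    bijection \<open>f\<close>.\<close>
  have nth: "mset z = image_mset ((!) z) (mset_set {..<n})" if "length z = n" for z :: "bool list"
    using that by (metis map_nth mset_map mset_upt atLeast0LessThan)
  have "image_mset ((!) y) (mset_set {..<n}) = image_mset ((!) y) (image_mset f (mset_set {..<n}))"
    using assms(1) by (simp add: image_mset_mset_set bij_betw_def)
  also have "\<dots> = image_mset ((!) x) (mset_set {..<n})"
    using assms(2) by (auto simp: renamed_def multiset.map_comp intro!: image_mset_cong)
  finally show ?thesis using assms(2) nth by (simp add: renamed_def)
qed

text \<open>Both comparators compare the same two values, and injectivity of \<open>f\<close>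
  ensures that the updates hit corresponding positions only.\<close>

lemma renamed_apply_comparator:
  assumes "bij_betw f {..<n} {..<n}" "renamed n f x y" "i < n" "j < n"
  shows "renamed n f (apply_comparator (i, j) x) (apply_comparator (f i, f j) y)"
proof -
  have inj: "f a = f b \<longleftrightarrow> a = b" if "a < n" "b < n" for a b
    using assms(1) that by (auto simp: bij_betw_def inj_on_def)
  have "f a < n" if "a < n" for a
    using assms(1) that by (auto simp: bij_betw_def)
  then show ?thesis
    using assms(2-4) by (auto simp: renamed_def nth_list_update inj)
qed

lemma renamed_apply_network:
  assumes "bij_betw f {..<n} {..<n}" "renamed n f x y" "network_on n D"
  shows "renamed n f (apply_network D x) (apply_network (map (map_prod f f) D) y)"
  using assms(2,3)
proof (induction D arbitrary: x y)
  case (Cons c D)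
  obtain i j where c: "c = (i, j)" by (cases c)
  have "i < n" "j < n" "network_on n D" using Cons.prems c by (auto simp: network_on_def)
  then show ?case
    using Cons.IH[OF renamed_apply_comparator[OF assms(1) Cons.prems(1)]] c by simp
qed simp

lemma network_on_rename:
  assumes "bij_betw f {..<n} {..<n}" "network_on n D"
  shows "network_on n (map (map_prod f f) D)"
  using assms by (fastforce simp: network_on_def bij_betw_def inj_on_def)

text \<open>The two orientations differ by an exchange of channels \<open>i\<close> and
  \<open>j\<close>. Renaming \<open>D\<close> by this transposition carries the exchange to the end
  of the network, where it preserves equality of outputs.\<close>

lemma collapsing_flip_comparator:
  assumes "collapsing n (C @ (i, j) # D)" "network_on n ((i, j) # D)"
  obtains D' where "network_on n D'" "length D' = length D" "collapsing n (C @ (j, i) # D')"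
proof -
  define f where "f = transpose i j"
  define D' where "D' = map (map_prod f f) D"
  have ij: "i < n" "j < n" "i \<noteq> j" and D: "network_on n D"
    using assms(2) by (auto simp: network_on_def)
  have bij: "bij_betw f {..<n} {..<n}"
    unfolding f_def using ij by (intro bij_betw_transpose_iff) simp
  have flip: "renamed n f (apply_comparator (i, j) v) (apply_comparator (j, i) v)"
    if "length v = n" for v
    using that ij by (auto simp: renamed_def f_def transpose_def nth_list_update)
  have "renamed n f (apply_network (C @ (i, j) # D) x) (apply_network (C @ (j, i) # D') x)"
    if "length x = n" for x
    using renamed_apply_network[OF bij flip D, of "apply_network C x"] that by (simp add: D'_def)
  then have "collapsing n (C @ (j, i) # D')"
    using assms(1) renamed_unique[OF bij] unfolding collapsing_def by metis
  then show thesis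
    using network_on_rename[OF bij D] that by (simp add: D'_def)
qed

text \<open>Pulling \<open>D\<close> back along \<pi> makes \<open>C @ D'\<close> on
  \<open>x\<close> agree, up to renaming, with \<open>C' @ D\<close> on some \<open>x'\<close> that
  has as many ones as \<open>x\<close>. Collapsing thus transfers from the latter to the
  former.\<close>

lemma subsumes_collapsing:
  assumes "represents_perm n \<pi>" "subsumes n C \<pi> C'" "collapsing n (C' @ D)" "network_on n D"
  obtains D' where "network_on n D'" "length D' = length D" "collapsing n (C @ D')"
proof -
  define f where "f = (!) \<pi>"
  define g where "g = inv_into {..<n} f"
  define D' where "D' = map (map_prod g g) D"
  have inj: "inj_on f {..<n}" and sub: "f ` {..<n} \<subseteq> {..<n}"
    using assms(1) by (auto simp: f_def represents_perm_def inj_on_def nth_eq_iff_index_eq)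
  have bij: "bij_betw f {..<n} {..<n}"
    using inj sub by (simp add: bij_betw_def endo_inj_surj)
  then have bij': "bij_betw g {..<n} {..<n}"
    unfolding g_def by (rule bij_betw_inv_into)
  have D': "network_on n D'"
    unfolding D'_def using bij' assms(4) by (rule network_on_rename)
  have "map (map_prod f f) D' = map id D"
    unfolding D'_def map_map using assms(4) bij
    by (intro map_cong) (auto simp: network_on_def g_def bij_betw_inv_into_right)
  then have D: "map (map_prod f f) D' = D" by simp
  have perm: "renamed n f v (permute \<pi> v)" if "length v = n" for v
    using permute_nth[OF assms(1) that] that by (simp add: renamed_def f_def)
  have image: "\<exists>x'. length x' = n \<and> mset x' = mset x \<and>
      renamed n f (apply_network (C @ D') x) (apply_network (C' @ D) x')"
    if x: "length x = n" for x
  proof -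
    let ?v = "apply_network C x"
    have "?v \<in> outputs n C" using x by (auto simp: outputs_def)
    then have "permute \<pi> ?v \<in> outputs n C'" using assms(2) by (auto simp: subsumes_def)
    then obtain x' where x': "length x' = n" "permute \<pi> ?v = apply_network C' x'"
      by (auto simp: outputs_def)
    have ren: "renamed n f ?v (apply_network C' x')"
      using perm[of ?v] x x' by simp
    \<comment> \<open>\<open>C\<close>, \<open>C'\<close> and the renaming all preserve the number
      of ones.\<close>
    then have "mset x' = mset x"
      using renamed_mset[OF bij] by fastforce
    moreover have "renamed n f (apply_network (C @ D') x) (apply_network (C' @ D) x')"
      using renamed_apply_network[OF bij ren D'] D by simp
    ultimately show ?thesis using x' by blast
  qed
  have "collapsing n (C @ D')"
    unfolding collapsing_def
  proof (intro allI impI)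
    fix x y :: "bool list"
    assume len: "length x = n" "length y = n" and eq: "mset x = mset y"
    obtain x' where x': "length x' = n" "mset x' = mset x"
      and ren_x: "renamed n f (apply_network (C @ D') x) (apply_network (C' @ D) x')"
      using image[OF len(1)] by blast
    obtain y' where y': "length y' = n" "mset y' = mset y"
      and ren_y: "renamed n f (apply_network (C @ D') y) (apply_network (C' @ D) y')"
      using image[OF len(2)] by blast
    have "apply_network (C' @ D) x' = apply_network (C' @ D) y'"
      using assms(3) x' y' eq unfolding collapsing_def by metis
    then show "apply_network (C @ D') x = apply_network (C @ D') y"
      using ren_x ren_y renamed_inj by metis
  qed
  then show thesis using D' that by (simp add: D'_def)
qed

section \<open>The invariant under generation and pruning\<close>

text \<open>The invariant of the procedure, with \<open>l\<close> the budget of comparators left.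
  \<open>D\<close> is only a network on \<open>n\<close> channels, since renaming may destroy
  standardness; the members of \<open>R\<close> stay standard, so that a collapsing one
  sorts.\<close>

definition extendable :: "nat \<Rightarrow> network list \<Rightarrow> nat \<Rightarrow> bool" where
  "extendable n R l \<longleftrightarrow>
    (\<forall>C \<in> set R. standard n C) \<and>
    (\<exists>C \<in> set R. \<exists>D. network_on n D \<and> length D \<le> l \<and> collapsing n (C @ D))"

lemma set_OGenerate:
  "set (OGenerate R n) =
    {C @ [(i, j)] | C i j. C \<in> set R \<and> i < j \<and> j < n \<and> \<not> redundant n C (i, j)}"
  unfolding OGenerate_def by (auto simp del: redundant.simps)

lemma OGenerate_collapsing:
  assumes "C \<in> set R" "\<not> collapsing n C" "network_on n D" "collapsing n (C @ D)"
  shows "\<exists>C' \<in> set (OGenerate R n). \<exists>D'. network_on n D' \<and> length D' < length D \<and>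
    collapsing n (C' @ D')"
  using assms(3,4)
proof (induction D rule: length_induct)
  case (1 D)
  have "D \<noteq> []" using 1(3) assms(2) by auto
  then obtain i\<^sub>0 j\<^sub>0 E where D: "D = (i\<^sub>0, j\<^sub>0) # E" by (metis list.exhaust surj_pair)
  obtain i j D' where ij: "i < j" "j < n" and D': "network_on n D'" "length D' < length D"
    "collapsing n (C @ (i, j) # D')"
  proof (cases "i\<^sub>0 < j\<^sub>0")
    case True
    then show thesis using that[of i\<^sub>0 j\<^sub>0 E] 1(2,3) D by (simp add: network_on_def)
  next
    case False
    obtain D' where "network_on n D'" "length D' = length E" "collapsing n (C @ (j\<^sub>0, i\<^sub>0) # D')"
      using collapsing_flip_comparator 1(2,3) D by metis
    moreover have "j\<^sub>0 < i\<^sub>0" "i\<^sub>0 < n" using False 1(2) D by (auto simp: network_on_def)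
    ultimately show thesis using that D by auto
  qed
  show ?case
  proof (cases "redundant n C (i, j)")
    case True
    then have "apply_comparator (i, j) (apply_network C x) = apply_network C x"
      if "length x = n" for x
      using that apply_comparator_redundant by simp
    then have "collapsing n (C @ D')"
      using D'(3) unfolding collapsing_def by (metis apply_network_append apply_network_Cons)
    then show ?thesis
      \<comment> \<open>The induction hypothesis applies to \<open>D'\<close>, which now extends
        \<open>C\<close> directly.\<close>
      using 1(1) D' by (meson order.strict_trans)
  next
    case False
    then have "C @ [(i, j)] \<in> set (OGenerate R n)"
      unfolding set_OGenerate using assms(1) ij by blast
    moreover have "collapsing n ((C @ [(i, j)]) @ D')" using D'(3) by simp
    ultimately show ?thesis using D'(1,2) by blast
  qed
qed

lemma extendable_OGenerate:
  assumes "extendable n R (Suc l)" "\<forall>C \<in> set R. \<not> sorting_network n C"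
  shows "extendable n (OGenerate R n) l"
proof -
  obtain C D where C: "C \<in> set R" and D: "network_on n D" "length D \<le> Suc l" "collapsing n (C @ D)"
    using assms(1) unfolding extendable_def by blast
  have "\<not> collapsing n C"
    using C assms standard_collapsing_imp_sorting_network unfolding extendable_def by blast
  then have "\<exists>C' \<in> set (OGenerate R n). \<exists>D'. network_on n D' \<and> length D' \<le> l \<and>
      collapsing n (C' @ D')"
    using OGenerate_collapsing[OF C _ D(1,3)] D(2) by (meson less_Suc_eq_le less_le_trans)
  moreover have "standard n C" if C: "C \<in> set (OGenerate R n)" for C
  proof -
    obtain B i j where "C = B @ [(i, j)]" "B \<in> set R" "i < j" "j < n"
      using C unfolding set_OGenerate by blast
    then show ?thesis using assms(1) by (simp add: extendable_def standard_def)
  qed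
  ultimately show ?thesis unfolding extendable_def by blast
qed

lemma extendable_Prune: "extendable n R l \<Longrightarrow> extendable n (Prune X R n) l"
proof (induction X R n rule: Prune.induct)
  case (2 C C' \<pi> X R n)
  show ?case
  proof (cases "C = C' \<or> C \<notin> set R \<or> \<not> represents_perm n \<pi> \<or> \<not> subsumes n C \<pi> C'")
    case True
    then show ?thesis using 2(2) by simp
  next
    case False
    \<comment> \<open>\<open>C\<close> differs from \<open>C'\<close>, so it survives the removal
      and can replace \<open>C'\<close> as the extendable network.\<close>
    then have C: "C \<in> set (removeAll C' R)" "represents_perm n \<pi>" "subsumes n C \<pi> C'" by auto
    obtain B D where B: "B \<in> set R" and D: "network_on n D" "length D \<le> l" "collapsing n (B @ D)"
      using 2(2) unfolding extendable_def by blast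
    have "\<exists>B' \<in> set (removeAll C' R). \<exists>D'. network_on n D' \<and> length D' \<le> l \<and>
      collapsing n (B' @ D')"
    proof (cases "B = C'")
      case True
      then show ?thesis using subsumes_collapsing[OF C(2,3)] D C(1) by metis
    next
      case False
      then show ?thesis using B D by auto
    qed
    then have "extendable n (removeAll C' R) l"
      using 2(2) by (simp add: extendable_def)
    then show ?thesis using False 2(1) by simp
  qed
qed simp

section \<open>The lower bound from the procedure\<close>

lemma not_sorting_network_Nil: "2 \<le> n \<Longrightarrow> \<not> sorting_network n []"
proof
  assume "2 \<le> n" "sorting_network n []"
  then obtain k where n: "n = Suc (Suc k)" by (metis Suc_le_D numeral_2_eq_2 Suc_le_mono)
  have "sorted (True # False # replicate k False)"
    using \<open>sorting_network n []\<close> n unfolding sorting_network_def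
    by (metis apply_network_Nil length_Cons length_replicate)
  then show False by simp
qed

text \<open>With no budget the extension is empty, so some member of \<open>R\<close> is standard
  and collapsing, hence sorts.\<close>

lemma extendable_length_pos:
  assumes "extendable n R l" "\<forall>C \<in> set R. \<not> sorting_network n C"
  shows "0 < l"
proof (rule ccontr)
  assume "\<not> 0 < l"
  then obtain C where "C \<in> set R" "collapsing n C"
    using assms(1) by (auto simp: extendable_def)
  then show False
    using assms standard_collapsing_imp_sorting_network by (auto simp: extendable_def)
qed

text \<open>Each round spends one comparator of the budget, which starts at \<open>length S\<close>.
  Writing \<open>length S = n + l\<close> avoids truncated subtraction.\<close>

lemma GP_No_extendable:
  assumes "GP m n Os = No p q R" "sorting_network m S"
  shows "p = m \<and> (\<forall>C \<in> set R. \<not> sorting_network m C) \<and>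
    (\<exists>l. length S = n + l \<and> extendable m R l)"
  using assms
proof (induction m n Os arbitrary: p q R rule: GP.induct)
  case (1 m Os)
  then have "2 \<le> m" "p = m" "R = [[]]" by (auto split: if_splits)
  \<comment> \<open>The empty network is extended by \<open>S\<close> itself.\<close>
  moreover have "extendable m [[]] (length S)"
    using 1(2) sorting_network_imp_collapsing
    by (auto simp: extendable_def standard_def sorting_network_def)
  ultimately show ?case using not_sorting_network_Nil by auto
next
  case (2 m n)
  then show ?case by simp
next
  case (3 m n X Os)
  obtain p' q' R' where G: "GP m n Os = No p' q' R'"
    using 3(2) by (auto split: answer.splits)
  then obtain l where IH: "p' = m" "\<forall>C \<in> set R'. \<not> sorting_network m C"
    "length S = n + l" "extendable m R' l"
    using 3(1)[OF G 3(3)] by blast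
  then obtain l' where l: "l = Suc l'"
    using extendable_length_pos by (metis gr0_implies_Suc)
  have "p = m" "R = Prune X (OGenerate R' m) m" "\<forall>C \<in> set R. \<not> sorting_network m C"
    using 3(2) G IH(1) by (auto simp: Let_def split: if_splits)
  moreover from this have "extendable m R l'"
    using IH l extendable_OGenerate extendable_Prune by metis
  ultimately show ?case using IH(3) l by simp
qed

theorem mainTheorem7:
  fixes m n :: nat and Os :: "gp_oracle list" and R :: "network list"
  assumes "GP m n Os = No m n R"
  shows "\<forall>C. sorting_network m C \<longrightarrow> length C > n"
proof (intro allI impI)
  fix C
  assume "sorting_network m C"
  then obtain l where "length C = n + l" "extendable m R l" "\<forall>C \<in> set R. \<not> sorting_network m C"
    using GP_No_extendable[OF assms] by blast
  \<comment> \<open>The inequality is strict because the last \<open>R\<close> has no sorting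
    network, which forces \<open>0 < l\<close>.\<close>
  then show "n < length C" using extendable_length_pos by auto
qed

end
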